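(* Let $V$ be a separable real Hilbert space with scalar product $(\cdot,\cdot)_V$ and norm $\|\cdot\|_V$. Let $\tilde x,\bar y\in V$, $R>0$ and $l<0$, and let $F:B_V(\tilde x,R)\to\mathcal{CBC}(V)$ be a multivalued mapping. (a) Let $F$ be bounded and compactly upper hemicontinuous (c-uhc). If there exists some $\tilde y\in F(\tilde x)$ such that $\|\bar y-\tilde y\|_V\le -lR$ and $$\forall x\in B_V(\tilde x,R)\ \exists y\in F(x):\quad (y-\tilde y,x-\tilde x)_V\le l\|x-\tilde x\|_V^2,$$ then there exists some $$\bar x\in B_V\bigl(x_c,-\tfrac{1}{2l}\|\tilde y-\bar y\|_V\bigr)\quad\text{with}\quad x_c=\tilde x+\tfrac{1}{2l}(\bar y-\tilde y),$$ satisfying $\bar y\in F(\bar x)$. (b) If $F$ admits a modulus of continuity $\omega$ relative to $\tilde x$ in the sense that $$e_V(F(x),F(\tilde x))\le\omega(\|x-\tilde x\|_V)$$ for all $x\in B_V(\tilde x,r)$ and some $r\le R$ with $r\le\min\omega^{-1}\bigl(\mathrm{dist}_V(\bar y,F(\tilde x))\bigr)$, then $$\|x-\tilde x\|_V\ge r\quad\text{for all } x\in F^{-1}(\bar y)\cap B_V(\tilde x,R).$$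
   Context: $B_V(x,R)=\{y\in V:\|y-x\|_V\le R\}$ is the closed ball. $\mathcal{CBC}(V)$ is the set of all nonempty closed, bounded and convex subsets of $V$. $\mathrm{dist}_V(x,M')=\inf_{x'\in M'}\|x-x'\|_V$ and $e_V(M,M')=\sup_{x\in M}\mathrm{dist}_V(x,M')$ for nonempty $M,M'\subset V$. $F^{-1}(\bar y)=\{x: \bar y\in F(x)\}$. Support function: $\sigma_V(v,A)=\sup_{y\in A}(y,v)_V$ for $v\in V$, $A\in\mathcal{CBC}(V)$. A mapping $F:M\to\mathcal{CBC}(V)$ on a weakly sequentially closed set $M\subset V$ is called compactly upper hemicontinuous (c-uhc) if for any sequence $(x_k)_{k}\subset M$ converging weakly to some $x\in M$ one has $\limsup_{k\to\infty}\sigma_V(v,F(x_k))\le\sigma_V(v,F(x))$ for all $v\in V$. $F$ is bounded if $\sup_{x}\sup_{y\in F(x)}\|y\|_V<\infty$, where $x$ ranges over the domain of $F$. A modulus of continuity is a continuous nondecreasing function $\omega:[0,\infty)\to[0,\infty)$ with $\omega(0)=0$; $\omega^{-1}(d)=\{t\ge 0:\omega(t)=d\}$ is the preimage, and in (b) it is understood that $\omega^{-1}(\mathrm{dist}_V(\bar y,F(\tilde x)))$ is nonempty so that its minimum makes sense. *)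

theory Defs
  imports "HOL-Analysis.Analysis"
begin

definition cbc :: "'a::real_normed_vector set set" where
  "cbc = {A. A \<noteq> {} \<and> closed A \<and> bounded A \<and> convex A}"

(* The two suprema below are taken in the reals, so they are meaningful only for nonempty
   bounded A resp. M, in particular for members of cbc. *)
definition support_fun :: "'a::real_inner \<Rightarrow> 'a set \<Rightarrow> real" where
  "support_fun v A = (SUP y\<in>A. y \<bullet> v)"

definition excess :: "'a::metric_space set \<Rightarrow> 'a set \<Rightarrow> real" where
  "excess M M' = (SUP x\<in>M. infdist x M')"

definition weakly_converges :: "(nat \<Rightarrow> 'a::real_normed_vector) \<Rightarrow> 'a \<Rightarrow> bool" where
  "weakly_converges X x \<longleftrightarrow>
     (\<forall>f :: 'a \<Rightarrow> real. bounded_linear f \<longrightarrow> (\<lambda>k. f (X k)) \<longlonglongrightarrow> f x)"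

definition weakly_seq_closed :: "'a::real_normed_vector set \<Rightarrow> bool" where
  "weakly_seq_closed M \<longleftrightarrow>
     (\<forall>X x. (\<forall>k. X k \<in> M) \<longrightarrow> weakly_converges X x \<longrightarrow> x \<in> M)"

lemma weakly_seq_closed_cball: "weakly_seq_closed (cball (c::'a::real_inner) R)"
  unfolding weakly_seq_closed_def
proof (intro allI impI)
  fix X :: "nat \<Rightarrow> 'a" and x
  assume X: "\<forall>k. X k \<in> cball c R" and w: "weakly_converges X x"
  have bl: "bounded_linear (\<lambda>z. z \<bullet> (x - c))"
    by (rule bounded_linear_inner_left)
  have "(\<lambda>k. X k \<bullet> (x - c)) \<longlonglongrightarrow> x \<bullet> (x - c)"
    using w bl unfolding weakly_converges_def by blast
  then have "(\<lambda>k. X k \<bullet> (x - c) - c \<bullet> (x - c)) \<longlonglongrightarrow> x \<bullet> (x - c) - c \<bullet> (x - c)"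
    by (intro tendsto_diff tendsto_const)
  moreover have "X k \<bullet> (x - c) - c \<bullet> (x - c) \<le> R * norm (x - c)" for k
  proof -
    have "(X k - c) \<bullet> (x - c) \<le> norm (X k - c) * norm (x - c)"
      by (rule norm_cauchy_schwarz)
    also have "\<dots> \<le> R * norm (x - c)"
      using X by (intro mult_right_mono) (auto simp: dist_norm norm_minus_commute)
    finally show ?thesis by (simp add: inner_diff_left)
  qed
  ultimately have "x \<bullet> (x - c) - c \<bullet> (x - c) \<le> R * norm (x - c)"
    by (intro LIMSEQ_le_const2) auto
  then have "norm (x - c) * norm (x - c) \<le> R * norm (x - c)"
    by (simp add: inner_diff_left[symmetric] dot_square_norm power2_eq_square)
  moreover have "0 \<le> R"
    using X zero_le_dist[of c "X 0"] by (metis mem_cball order_trans)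
  ultimately have "norm (x - c) \<le> R"
    by (cases "norm (x - c) = 0") auto
  then show "x \<in> cball c R"
    by (simp add: dist_norm norm_minus_commute)
qed

(* A set-valued map with domain M is a total function F whose values outside M are ignored. *)
definition c_uhc_on :: "'a::real_inner set \<Rightarrow> ('a \<Rightarrow> 'a set) \<Rightarrow> bool" where
  "c_uhc_on M F \<longleftrightarrow> weakly_seq_closed M \<and>
     (\<forall>X x. (\<forall>k. X k \<in> M) \<longrightarrow> x \<in> M \<longrightarrow> weakly_converges X x \<longrightarrow>
        (\<forall>v. limsup (\<lambda>k. ereal (support_fun v (F (X k)))) \<le> ereal (support_fun v (F x))))"

definition modulus_of_continuity :: "(real \<Rightarrow> real) \<Rightarrow> bool" where
  "modulus_of_continuity \<omega> \<longleftrightarrow>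
     continuous_on {0..} \<omega> \<and> mono_on {0..} \<omega> \<and> (\<forall>t\<ge>0. 0 \<le> \<omega> t) \<and> \<omega> 0 = 0"

definition modulus_preimage :: "(real \<Rightarrow> real) \<Rightarrow> real \<Rightarrow> real set" where
  "modulus_preimage \<omega> d = {t. 0 \<le> t \<and> \<omega> t = d}"

(* Min is reserved for finite sets; a nonempty preimage under a modulus of continuity is closed
   and bounded below, so LEAST is its genuine minimum. *)
lemma modulus_preimage_Least:
  assumes "modulus_of_continuity \<omega>" and "modulus_preimage \<omega> d \<noteq> {}"
  shows "(LEAST t. t \<in> modulus_preimage \<omega> d) \<in> modulus_preimage \<omega> d"
    and "\<And>t. t \<in> modulus_preimage \<omega> d \<Longrightarrow> (LEAST t. t \<in> modulus_preimage \<omega> d) \<le> t"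
proof -
  let ?S = "modulus_preimage \<omega> d"
  have S: "?S = {0..} \<inter> \<omega> -` {d}"
    by (auto simp: modulus_preimage_def)
  have "closed ?S"
    unfolding S using assms(1)
    by (intro continuous_closed_preimage) (auto simp: modulus_of_continuity_def)
  moreover have bdd: "bdd_below ?S"
    by (auto simp: modulus_preimage_def intro!: bdd_belowI[of _ 0])
  ultimately have inf: "Inf ?S \<in> ?S"
    using assms(2) closed_contains_Inf by blast
  have eq: "(LEAST t. t \<in> ?S) = Inf ?S"
    using inf by (intro Least_equality) (auto intro: cInf_lower[OF _ bdd])
  show "(LEAST t. t \<in> ?S) \<in> ?S" using inf eq by simp
  show "\<And>t. t \<in> ?S \<Longrightarrow> (LEAST t. t \<in> ?S) \<le> t"
    unfolding eq by (rule cInf_lower[OF _ bdd])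
qed

definition set_valued_preimage :: "('a \<Rightarrow> 'b set) \<Rightarrow> 'b \<Rightarrow> 'a set" where
  "set_valued_preimage F y = {x. y \<in> F x}"

end

theory Submission
  imports Defs "HOL-Library.Diagonal_Subsequence"
begin

text \<open>
  Write \<open>D\<close> for the ball in which the solution is sought. One of its diameters starts at
  \<open>xt\<close>, and it consists exactly of the \<open>x\<close> with
  \<open>(ybar - yt) \<bullet> (x - xt) \<le> l * (norm (x - xt))\<^sup>2\<close>. Comparing this with the hypothesis on
  \<open>F\<close>, every \<open>x\<close> of the large ball outside \<open>D\<close> has some \<open>y \<in> F x\<close> with
  \<open>(y - ybar) \<bullet> (x - xt) < 0\<close>. So \<open>F - ybar\<close> has a selection with negative
  component in the direction \<open>x - xt\<close> everywhere off \<open>D\<close>, and with no outward component on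
  the sphere of radius \<open>R\<close> around \<open>xt\<close>; a topological argument then produces a solution, and
  produces it in \<open>D\<close>.
  
  The solution is found by a Galerkin method. On a finite-dimensional section of the large ball the
  inclusion is tested only against directions of that section (\<open>galerkin_solution\<close>). Were there
  no solution in \<open>D\<close>, continuous weights would combine the separating directions on \<open>D\<close> and
  the radial direction off \<open>D\<close> to a continuous nowhere vanishing field that is never directed
  from the boundary to the centre, against Brouwer's theorem (\<open>field_zero_or_inward\<close>). Brouwer's
  theorem is needed in every dimension at once and is derived from Kuhn's combinatorial lemma
  (\<open>brouwer_orthonormal_cube\<close>).
  
  The finite-dimensional solutions then have a weakly convergent subsequence
  (\<open>bounded_weakly_convergent_subsequence\<close>). The semicontinuity of \<open>F\<close> bounds
  \<open>ybar \<bullet> v\<close> by the support function of \<open>F\<close> at the weak limit, for a dense set of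
  \<open>v\<close>, and separation puts \<open>ybar\<close> into the value of \<open>F\<close>
  (\<open>mem_cbc_of_support_fun_dense\<close>).
  
  Part (b) is the observation that a solution \<open>x\<close> satisfies
  \<open>infdist ybar (F xt) \<le> excess (F x) (F xt)\<close>, which the modulus excludes close to \<open>xt\<close>.
\<close>

section \<open>Projections, Riesz representation and weak compactness in Hilbert spaces\<close>

lemma closest_point_exists_hilbert:
  fixes S :: "'a::{real_inner, banach} set"
  assumes "closed S" "convex S" "S \<noteq> {}"
  obtains p where "p \<in> S" "\<forall>z\<in>S. dist a p \<le> dist a z"
proof -
  define d where "d = infdist a S"
  have d_le: "d \<le> dist a z" if "z \<in> S" for z
    unfolding d_def using that by (rule infdist_le)
  have d0: "0 \<le> d" unfolding d_def by (rule infdist_nonneg)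
  have "\<exists>y\<in>S. dist a y < d + 1 / Suc n" for n
  proof -
    have "Inf (dist a ` S) < d + 1 / Suc n"
      using assms(3) by (simp add: d_def infdist_notempty)
    then show ?thesis using cInf_lessD[of "dist a ` S"] assms(3) by blast
  qed
  then obtain y where yS: "\<And>n. y n \<in> S" and y: "\<And>n. dist a (y n) < d + 1 / Suc n"
    by metis
  \<comment> \<open>A minimising sequence is Cauchy by the parallelogram law at the midpoint.\<close>
  have "Cauchy y"
  proof (rule metric_CauchyI)
    fix e :: real assume e: "e > 0"
    have "(\<lambda>n. (d + inverse (real (Suc n)))\<^sup>2) \<longlonglongrightarrow> (d + 0)\<^sup>2"
      by (intro tendsto_intros LIMSEQ_inverse_real_of_nat)
    then have "\<forall>\<^sub>F n in sequentially. (d + inverse (real (Suc n)))\<^sup>2 < d\<^sup>2 + e\<^sup>2 / 4"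
      by (rule order_tendstoD) (use e in auto)
    then obtain N where N: "(d + inverse (real (Suc n)))\<^sup>2 < d\<^sup>2 + e\<^sup>2 / 4" if "n \<ge> N" for n
      by (auto simp: eventually_sequentially)
    have close: "(dist a (y n))\<^sup>2 < d\<^sup>2 + e\<^sup>2 / 4" if "n \<ge> N" for n
    proof -
      have "(dist a (y n))\<^sup>2 \<le> (d + inverse (real (Suc n)))\<^sup>2"
        using y[of n] by (intro power_mono) (auto simp: inverse_eq_divide)
      then show ?thesis using N[OF that] by linarith
    qed
    have "dist (y m) (y n) < e" if "m \<ge> N" "n \<ge> N" for m n
    proof -
      let ?z = "(1/2) *\<^sub>R y m + (1/2) *\<^sub>R y n"
      have "?z \<in> S" using assms(2) yS by (intro convexD) auto
      then have "d\<^sup>2 \<le> (dist a ?z)\<^sup>2" using d_le d0 by (intro power_mono) auto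
      moreover have "(dist (y m) (y n))\<^sup>2 = 2 * (dist a (y m))\<^sup>2 + 2 * (dist a (y n))\<^sup>2 - 4 * (dist a ?z)\<^sup>2"
        unfolding dist_norm power2_norm_eq_inner by (simp add: algebra_simps inner_commute)
      ultimately have "(dist (y m) (y n))\<^sup>2 < e\<^sup>2"
        using close[OF that(1)] close[OF that(2)] by linarith
      then show ?thesis using e by (simp add: power_less_imp_less_base)
    qed
    then show "\<exists>M. \<forall>m\<ge>M. \<forall>n\<ge>M. dist (y m) (y n) < e" by blast
  qed
  then obtain p where p: "y \<longlonglongrightarrow> p" using Cauchy_convergent convergent_def by blast
  have "(\<lambda>n. d + inverse (real (Suc n))) \<longlonglongrightarrow> d + 0"
    by (intro tendsto_intros LIMSEQ_inverse_real_of_nat)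
  moreover have "(\<lambda>n. dist a (y n)) \<longlonglongrightarrow> dist a p" using p by (intro tendsto_intros)
  ultimately have "dist a p \<le> d + 0"
    using y by (intro LIMSEQ_le) (auto simp: inverse_eq_divide intro: less_imp_le)
  then have "\<forall>z\<in>S. dist a p \<le> dist a z" using d_le by (auto intro: order_trans)
  moreover have "p \<in> S" using closed_sequentially[OF assms(1) _ p] yS by blast
  ultimately show ?thesis using that by blast
qed

text \<open>
  The variational inequality characterising the metric projection onto \<open>S\<close>.
\<close>

lemma projection_hilbert:
  fixes S :: "'a::{real_inner, banach} set"
  assumes "closed S" "convex S" "S \<noteq> {}"
  obtains p where "p \<in> S" "\<And>z. z \<in> S \<Longrightarrow> (a - p) \<bullet> (z - p) \<le> 0"
  using closest_point_exists_hilbert[OF assms, of a] any_closest_point_dot[OF assms(2,1)] by metis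

lemma riesz_representation:
  fixes f :: "'a::{real_inner, banach} \<Rightarrow> real"
  assumes f: "bounded_linear f"
  obtains x where "\<And>v. f v = v \<bullet> x"
proof (cases "\<forall>v. f v = 0")
  case True
  then show ?thesis using that[of 0] by simp
next
  case False
  interpret f: bounded_linear f by fact
  \<comment> \<open>The representing vector is a multiple of the point of least norm on the hyperplane \<open>f = 1\<close>.\<close>
  define S where "S = {v. f v = 1}"
  obtain u where u: "f u \<noteq> 0" using False by blast
  have "closed S" unfolding S_def
    by (intro closed_Collect_eq continuous_intros f.continuous_on)
  moreover have "convex S" unfolding S_def convex_def by (auto simp: f.add f.scaleR)
  moreover have "u /\<^sub>R f u \<in> S" using u by (simp add: S_def f.scaleR)
  ultimately obtain p where p: "p \<in> S" "\<And>z. z \<in> S \<Longrightarrow> (0 - p) \<bullet> (z - p) \<le> 0"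
    using projection_hilbert[of S 0] by blast
  have orth: "p \<bullet> w = 0" if "f w = 0" for w
  proof -
    have "p + w \<in> S" "p - w \<in> S" using p(1) that by (auto simp: S_def f.add f.diff)
    from this[THEN p(2)] show ?thesis by simp
  qed
  have "p \<noteq> 0" using p(1) by (auto simp: S_def f.zero)
  have "f v = v \<bullet> (p /\<^sub>R (p \<bullet> p))" for v
  proof -
    have "p \<bullet> (v - f v *\<^sub>R p) = 0"
      using p(1) by (intro orth) (simp add: S_def f.diff f.scaleR)
    then show ?thesis using \<open>p \<noteq> 0\<close> by (simp add: inner_diff_right inner_commute field_simps)
  qed
  then show ?thesis by (rule that)
qed

lemma weakly_converges_iff_inner:
  fixes X :: "nat \<Rightarrow> 'a::{real_inner, banach}"
  shows "weakly_converges X x \<longleftrightarrow> (\<forall>v. (\<lambda>k. X k \<bullet> v) \<longlonglongrightarrow> x \<bullet> v)"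
proof
  assume "weakly_converges X x"
  then show "\<forall>v. (\<lambda>k. X k \<bullet> v) \<longlonglongrightarrow> x \<bullet> v"
    unfolding weakly_converges_def using bounded_linear_inner_left by blast
next
  assume *: "\<forall>v. (\<lambda>k. X k \<bullet> v) \<longlonglongrightarrow> x \<bullet> v"
  show "weakly_converges X x"
    unfolding weakly_converges_def
  proof (intro allI impI)
    fix f :: "'a \<Rightarrow> real" assume "bounded_linear f"
    then obtain u where "\<And>v. f v = v \<bullet> u" by (rule riesz_representation) blast
    then show "(\<lambda>k. f (X k)) \<longlonglongrightarrow> f x" using * by simp
  qed
qed

lemma weakly_converges_of_convergent:
  assumes "X \<longlonglongrightarrow> x"
  shows "weakly_converges X x"
  unfolding weakly_converges_def using assms bounded_linear.tendsto by blast

lemma separable_space_dense_sequence: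
  assumes "separable_space (euclidean :: 'a::metric_space topology)"
  obtains d :: "nat \<Rightarrow> 'a::metric_space" where "closure (range d) = UNIV"
proof -
  obtain C :: "'a set" where C: "countable C" "closure C = UNIV"
    using assms by (auto simp: separable_space_def)
  then have "C \<noteq> {}" by auto
  then have "range (from_nat_into C) = C" using C(1) by (rule range_from_nat_into)
  then show ?thesis using that C(2) by metis
qed

text \<open>
  A diagonal subsequence converges when tested against every member of a dense sequence, and then,
  by boundedness, against every vector. The limits form a bounded linear functional, which the Riesz
  representation turns into the weak limit.
\<close>

lemma bounded_weakly_convergent_subsequence:
  fixes X :: "nat \<Rightarrow> 'a::{real_inner, banach}"
  assumes sep: "separable_space (euclidean :: 'a topology)" and M: "\<And>k. norm (X k) \<le> M"
  obtains r x where "strict_mono r" "weakly_converges (X \<circ> r) x"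
proof -
  have M0: "0 \<le> M" using M[of 0] norm_ge_zero order_trans by blast
  obtain d :: "nat \<Rightarrow> 'a" where d: "closure (range d) = UNIV"
    using separable_space_dense_sequence[OF sep] .
  interpret subseqs "\<lambda>n s. convergent (\<lambda>k. X (s k) \<bullet> d n)"
  proof
    fix n s assume "strict_mono (s :: nat \<Rightarrow> nat)"
    have "bounded (range (\<lambda>k. X (s k) \<bullet> d n))"
    proof (rule boundedI)
      fix z assume "z \<in> range (\<lambda>k. X (s k) \<bullet> d n)"
      then obtain k where "z = X (s k) \<bullet> d n" by blast
      then have "norm z \<le> norm (X (s k)) * norm (d n)" using Cauchy_Schwarz_ineq2 by simp
      also have "\<dots> \<le> M * norm (d n)" using M by (intro mult_right_mono) auto
      finally show "norm z \<le> M * norm (d n)" .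
    qed
    then obtain l r where "strict_mono r" "((\<lambda>k. X (s k) \<bullet> d n) \<circ> r) \<longlonglongrightarrow> l"
      using bounded_imp_convergent_subsequence by blast
    then show "\<exists>r. strict_mono r \<and> convergent (\<lambda>k. X ((s \<circ> r) k) \<bullet> d n)"
      by (auto simp: convergent_def o_def)
  qed
  define r where "r = diagseq"
  have r: "strict_mono r" unfolding r_def by (rule subseq_diagseq)
  have "convergent (\<lambda>k. X ((diagseq \<circ> ((+) (Suc n))) k) \<bullet> d n)" for n
  proof (rule diagseq_holds)
    fix r s :: "nat \<Rightarrow> nat" and n
    assume "strict_mono r" "convergent (\<lambda>k. X (s k) \<bullet> d n)"
    then show "convergent (\<lambda>k. X ((s \<circ> r) k) \<bullet> d n)"
      using convergent_subseq_convergent[of "\<lambda>k. X (s k) \<bullet> d n" r] by (simp add: o_def)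
  qed
  then have "convergent (\<lambda>k. X (r (k + Suc n)) \<bullet> d n)" for n
    unfolding r_def o_def by (simp only: add.commute)
  then have conv_d: "convergent (\<lambda>k. X (r k) \<bullet> d n)" for n
    using convergent_ignore_initial_segment[of "\<lambda>k. X (r k) \<bullet> d n"] by blast
  have conv: "convergent (\<lambda>k. X (r k) \<bullet> v)" for v
  proof -
    have "Cauchy (\<lambda>k. X (r k) \<bullet> v)"
    proof (rule metric_CauchyI)
      fix e :: real assume e: "e > 0"
      have "e / (3 * (M + 1)) > 0" using e M0 by simp
      then obtain n where n: "dist (d n) v < e / (3 * (M + 1))"
        using d closure_approachable[of v "range d"] by auto
      have near: "\<bar>X k \<bullet> v - X k \<bullet> d n\<bar> \<le> e / 3" for k
      proof -
        have "\<bar>X k \<bullet> (v - d n)\<bar> \<le> norm (X k) * norm (v - d n)" by (rule Cauchy_Schwarz_ineq2)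
        also have "\<dots> \<le> (M + 1) * (e / (3 * (M + 1)))"
          using M[of k] n M0 by (intro mult_mono) (auto simp: dist_norm norm_minus_commute)
        also have "\<dots> = e / 3" using M0 by (simp add: field_simps)
        finally show ?thesis by (simp add: inner_diff_right)
      qed
      have "Cauchy (\<lambda>k. X (r k) \<bullet> d n)" using conv_d Cauchy_convergent_iff by blast
      then obtain N where N: "\<And>i j. i \<ge> N \<Longrightarrow> j \<ge> N \<Longrightarrow> \<bar>X (r i) \<bullet> d n - X (r j) \<bullet> d n\<bar> < e / 3"
        using metric_CauchyD[of _ "e/3"] e by (force simp: dist_real_def)
      have "dist (X (r i) \<bullet> v) (X (r j) \<bullet> v) < e" if "i \<ge> N" "j \<ge> N" for i j
        using N[OF that] near[of "r i"] near[of "r j"] unfolding dist_real_def by linarith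
      then show "\<exists>N. \<forall>i\<ge>N. \<forall>j\<ge>N. dist (X (r i) \<bullet> v) (X (r j) \<bullet> v) < e" by blast
    qed
    then show ?thesis by (rule Cauchy_convergent)
  qed
  define f where "f v = lim (\<lambda>k. X (r k) \<bullet> v)" for v
  have f: "(\<lambda>k. X (r k) \<bullet> v) \<longlonglongrightarrow> f v" for v
    unfolding f_def using conv convergent_LIMSEQ_iff by blast
  have "bounded_linear f"
  proof (rule bounded_linear_intro)
    fix x y show "f (x + y) = f x + f y"
      using tendsto_add[OF f f, of x y] f[of "x + y"] by (intro LIMSEQ_unique) (auto simp: inner_add_right)
  next
    fix c x show "f (c *\<^sub>R x) = c *\<^sub>R f x"
      using tendsto_mult_left[OF f, of c x] f[of "c *\<^sub>R x"] by (intro LIMSEQ_unique) auto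
  next
    fix x
    have "\<bar>X (r k) \<bullet> x\<bar> \<le> norm x * M" for k
      using Cauchy_Schwarz_ineq2[of "X (r k)" x] M[of "r k"]
      by (smt (verit) mult.commute mult_left_mono norm_ge_zero)
    then show "norm (f x) \<le> norm x * M"
      using tendsto_rabs[OF f, of x] by (intro LIMSEQ_le_const2) auto
  qed
  then obtain x where "\<And>v. f v = v \<bullet> x" by (rule riesz_representation) blast
  then have "weakly_converges (X \<circ> r) x"
    using f by (simp add: weakly_converges_iff_inner inner_commute)
  then show ?thesis using that r by blast
qed

section \<open>Brouwer's theorem on finite-dimensional sections of a ball\<close>

lemma cube_sumI:
  fixes b :: "nat \<Rightarrow> 'a::real_normed_vector"
  assumes "z = (\<Sum>i<n. t i *\<^sub>R b i)" "\<And>i. i < n \<Longrightarrow> \<bar>t i\<bar> \<le> (R::real)"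
  shows "z \<in> (\<lambda>t. \<Sum>i<n. t i *\<^sub>R b i) ` {t. \<forall>i<n. \<bar>t i\<bar> \<le> R}"
  unfolding assms(1) by (rule imageI) (use assms(2) in simp)

lemma compact_cube_sum:
  fixes b :: "nat \<Rightarrow> 'a::real_normed_vector"
  shows "compact ((\<lambda>t. \<Sum>i<n. t i *\<^sub>R b i) ` {t. \<forall>i<n. \<bar>t i\<bar> \<le> (R::real)})"
proof (induction n)
  case 0
  then show ?case by (rule finite_imp_compact) (rule finite_subset[of _ "{0}"], auto)
next
  case (Suc n)
  let ?P = "\<lambda>n t. \<Sum>i<n. t i *\<^sub>R b i"
  let ?K = "\<lambda>n. ?P n ` {t. \<forall>i<n. \<bar>t i\<bar> \<le> R}"
  let ?L = "(\<lambda>s. s *\<^sub>R b n) ` {-R..R}"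
  have "?K (Suc n) = {x + y | x y. x \<in> ?K n \<and> y \<in> ?L}"
  proof (intro equalityI subsetI)
    fix z assume "z \<in> ?K (Suc n)"
    then obtain t where "\<forall>i<Suc n. \<bar>t i\<bar> \<le> R" "z = ?P (Suc n) t" by blast
    then have "z = ?P n t + t n *\<^sub>R b n" "?P n t \<in> ?K n"
      by (auto intro: cube_sumI)
    moreover have "t n *\<^sub>R b n \<in> ?L"
      using \<open>\<forall>i<Suc n. \<bar>t i\<bar> \<le> R\<close> by (intro imageI) (auto simp: abs_le_iff minus_le_iff)
    ultimately show "z \<in> {x + y | x y. x \<in> ?K n \<and> y \<in> ?L}" by blast
  next
    fix z assume "z \<in> {x + y | x y. x \<in> ?K n \<and> y \<in> ?L}"
    then obtain t s where t: "\<forall>i<n. \<bar>t i\<bar> \<le> R" "s \<in> {-R..R}" "z = ?P n t + s *\<^sub>R b n" by blast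
    have "z = ?P (Suc n) (t(n := s))" using t(3) by simp
    moreover have "\<forall>i<Suc n. \<bar>(t(n := s)) i\<bar> \<le> R" using t by (auto simp: less_Suc_eq)
    ultimately show "z \<in> ?K (Suc n)" by blast
  qed
  moreover have "compact ?L"
    by (intro compact_continuous_image continuous_intros compact_Icc)
  ultimately show ?case using compact_sums[OF Suc.IH] by simp
qed

text \<open>
  Brouwer's theorem on the cube spanned by \<open>n\<close> orthonormal vectors. The ambient space may have
  infinite dimension and the dimension \<open>n\<close> is a number, not a type, so that it can vary.
  The cube is divided into \<open>p\<^sup>n\<close> cells and each grid point is labelled by the signs of
  the coordinates of \<open>f x - x\<close>. Kuhn's combinatorial lemma yields a cell in which every
  coordinate takes both signs in the weak sense; a limit point of these cells for
  \<open>p \<rightarrow> \<infinity>\<close> is fixed by \<open>f\<close>.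
\<close>

lemma brouwer_orthonormal_cube:
  fixes b :: "nat \<Rightarrow> 'a::real_inner" and R :: real and n :: nat
  defines "K \<equiv> (\<lambda>t. \<Sum>i<n. t i *\<^sub>R b i) ` {t. \<forall>i<n. \<bar>t i\<bar> \<le> R}"
  assumes b: "\<And>i j. i < n \<Longrightarrow> j < n \<Longrightarrow> b i \<bullet> b j = (if i = j then 1 else 0)"
    and R: "R > 0" and cont: "continuous_on K f" and maps: "\<And>x. x \<in> K \<Longrightarrow> f x \<in> K"
  obtains x where "x \<in> K" "f x = x"
proof -
  let ?P = "\<lambda>t. \<Sum>i<n. t i *\<^sub>R b i"
  have coord: "?P t \<bullet> b i = t i" if "i < n" for t i
  proof -
    have "?P t \<bullet> b i = (\<Sum>j<n. t j * (b j \<bullet> b i))" by (simp add: inner_sum_left)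
    also have "\<dots> = (\<Sum>j<n. if j = i then t i else 0)"
      using that by (intro sum.cong) (auto simp: b)
    also have "\<dots> = t i" using that by simp
    finally show ?thesis .
  qed
  have KI: "?P t \<in> K" if "\<And>i. i < n \<Longrightarrow> \<bar>t i\<bar> \<le> R" for t
    unfolding K_def by (rule cube_sumI[OF refl that])
  have bdd: "\<bar>x \<bullet> b i\<bar> \<le> R" if "x \<in> K" "i < n" for x i
    using that coord unfolding K_def by auto
  have grid: "\<exists>z\<in>K. \<forall>i<n. \<exists>u\<in>K. \<exists>w\<in>K. dist u z \<le> real n * (2 * R) * inverse (Suc k) \<and>
      dist w z \<le> real n * (2 * R) * inverse (Suc k) \<and> (f u - u) \<bullet> b i \<ge> 0 \<and> (f w - w) \<bullet> b i \<le> 0" for k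
  proof -
    define p where "p = Suc k"
    have p: "p > 0" by (simp add: p_def)
    define \<gamma> :: "(nat \<Rightarrow> nat) \<Rightarrow> 'a" where "\<gamma> q = ?P (\<lambda>i. R * (2 * q i / p - 1))" for q
    have \<gamma>K: "\<gamma> q \<in> K" if "\<forall>i<n. q i \<le> p" for q
    proof -
      have "\<bar>R * (2 * real (q i) / p - 1)\<bar> \<le> R" if "i < n" for i
      proof -
        have "real (q i) / p \<le> 1" "0 \<le> real (q i) / p"
          using that \<open>\<forall>i<n. q i \<le> p\<close> p by auto
        then have "\<bar>2 * (real (q i) / p) - 1\<bar> \<le> 1" by linarith
        then have "R * \<bar>2 * (real (q i) / p) - 1\<bar> \<le> R * 1" using R by (intro mult_left_mono) auto
        then show ?thesis using R by (simp add: abs_mult)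
      qed
      then show ?thesis unfolding \<gamma>_def by (rule KI)
    qed
    \<comment> \<open>On the faces of the cube the prescribed labels are consistent with the signs, since \<open>f\<close> maps
      the cube into itself.\<close>
    define label :: "(nat \<Rightarrow> nat) \<Rightarrow> nat \<Rightarrow> nat" where
      "label q i = (if q i = 0 then 0 else if q i = p then 1
                    else if (f (\<gamma> q) - \<gamma> q) \<bullet> b i \<ge> 0 then 0 else 1)" for q i
    have label0: "(f (\<gamma> q) - \<gamma> q) \<bullet> b i \<ge> 0" if "\<forall>i<n. q i \<le> p" "i < n" "label q i = 0" for q i
    proof (cases "q i = 0")
      case True
      then have "\<gamma> q \<bullet> b i = - R" using that by (simp add: \<gamma>_def coord)
      then show ?thesis using bdd[OF maps[OF \<gamma>K] that(2), of q] that(1) by (simp add: inner_diff_left)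
    next
      case False
      then show ?thesis using that p by (auto simp: label_def split: if_splits)
    qed
    have label1: "(f (\<gamma> q) - \<gamma> q) \<bullet> b i \<le> 0" if "\<forall>i<n. q i \<le> p" "i < n" "label q i = 1" for q i
    proof (cases "q i = p")
      case True
      then have "\<gamma> q \<bullet> b i = R" using that p by (simp add: \<gamma>_def coord)
      then show ?thesis using bdd[OF maps[OF \<gamma>K] that(2), of q] that(1) by (simp add: inner_diff_left)
    next
      case False
      then show ?thesis using that by (auto simp: label_def split: if_splits)
    qed
    have label01: "label q i = 0 \<or> label q i = 1" for q i by (simp add: label_def)
    obtain q where q: "\<forall>i<n. q i < p"
      and rs: "\<forall>i<n. \<exists>r s. (\<forall>j<n. q j \<le> r j \<and> r j \<le> q j + 1) \<and>
                 (\<forall>j<n. q j \<le> s j \<and> s j \<le> q j + 1) \<and> label r i \<noteq> label s i"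
    proof (rule kuhn_lemma[of p n label])
      show "\<forall>x. (\<forall>i<n. x i \<le> p) \<longrightarrow> (\<forall>i<n. label x i = 0 \<or> label x i = 1)"
        using label01 by blast
      show "\<forall>x. (\<forall>i<n. x i \<le> p) \<longrightarrow> (\<forall>i<n. x i = 0 \<longrightarrow> label x i = 0)"
        by (simp add: label_def)
      show "\<forall>x. (\<forall>i<n. x i \<le> p) \<longrightarrow> (\<forall>i<n. x i = p \<longrightarrow> label x i = 1)"
        using p by (simp add: label_def)
    qed (rule p, rule that)
    have close: "dist (\<gamma> r) (\<gamma> q) \<le> real n * (2 * R) * inverse (Suc k)"
      if r: "\<forall>j<n. q j \<le> r j \<and> r j \<le> q j + 1" for r
    proof -
      have "\<gamma> r - \<gamma> q = (\<Sum>i<n. (R * (2 * (real (r i) - real (q i)) / p)) *\<^sub>R b i)"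
        unfolding \<gamma>_def sum_subtractf[symmetric] scaleR_diff_left[symmetric]
        by (intro sum.cong refl arg_cong2[where f = scaleR]) (simp add: diff_divide_distrib right_diff_distrib)
      also have "norm \<dots> \<le> (\<Sum>i<n. 2 * R * inverse (Suc k))"
      proof (rule sum_norm_le)
        fix i assume "i \<in> {..<n}"
        then have i: "i < n" by simp
        have "norm (b i) = 1" using b[OF i i] by (simp add: norm_eq_1)
        moreover have "\<bar>real (r i) - real (q i)\<bar> \<le> 1" using r i by force
        moreover have "R * (2 * (real (r i) - real (q i)) / p)
            = (2 * R * inverse (Suc k)) * (real (r i) - real (q i))"
          by (simp add: p_def divide_inverse)
        moreover have "(2 * R * inverse (Suc k)) * \<bar>real (r i) - real (q i)\<bar> \<le> (2 * R * inverse (Suc k)) * 1"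
          using calculation R by (intro mult_left_mono) auto
        ultimately show "norm ((R * (2 * (real (r i) - real (q i)) / p)) *\<^sub>R b i) \<le> 2 * R * inverse (Suc k)"
          using R by (simp only: norm_scaleR abs_mult[of "2 * R * inverse (Suc k)"]) simp
      qed
      finally show ?thesis by (simp add: dist_norm)
    qed
    show ?thesis
    proof (rule bexI[of _ "\<gamma> q"], intro allI impI)
      show "\<gamma> q \<in> K" using q by (intro \<gamma>K) (auto simp: less_imp_le)
      fix i assume i: "i < n"
      then obtain r s where r: "\<forall>j<n. q j \<le> r j \<and> r j \<le> q j + 1"
        and s: "\<forall>j<n. q j \<le> s j \<and> s j \<le> q j + 1" and ne: "label r i \<noteq> label s i" using rs by blast
      have rp: "\<forall>j<n. r j \<le> p" and sp: "\<forall>j<n. s j \<le> p" using r s q by (auto, (meson Suc_leI order_trans)+)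
      show "\<exists>u\<in>K. \<exists>w\<in>K. dist u (\<gamma> q) \<le> real n * (2 * R) * inverse (Suc k) \<and>
          dist w (\<gamma> q) \<le> real n * (2 * R) * inverse (Suc k) \<and> (f u - u) \<bullet> b i \<ge> 0 \<and> (f w - w) \<bullet> b i \<le> 0"
      proof (cases "label r i = 0")
        case True
        then have "label s i = 1" using ne label01[of s i] by simp
        then show ?thesis using True label0[OF rp i] label1[OF sp i] close[OF r] close[OF s]
            \<gamma>K[OF rp] \<gamma>K[OF sp] by blast
      next
        case False
        then have "label r i = 1" "label s i = 0" using ne label01[of s i] label01[of r i] by auto
        then show ?thesis using label0[OF sp i] label1[OF rp i] close[OF r] close[OF s]
            \<gamma>K[OF rp] \<gamma>K[OF sp] by blast
      qed
    qed
  qed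
  then obtain z where zK: "\<And>k. z k \<in> K"
    and z: "\<And>k i. i < n \<Longrightarrow> \<exists>u\<in>K. \<exists>w\<in>K. dist u (z k) \<le> real n * (2 * R) * inverse (Suc k) \<and>
      dist w (z k) \<le> real n * (2 * R) * inverse (Suc k) \<and> (f u - u) \<bullet> b i \<ge> 0 \<and> (f w - w) \<bullet> b i \<le> 0"
    by metis
  have "compact K" unfolding K_def by (rule compact_cube_sum)
  then have "seq_compact K" by (rule compact_imp_seq_compact)
  then obtain x r where x: "x \<in> K" and r: "strict_mono r" and lim: "(z \<circ> r) \<longlonglongrightarrow> x"
    using zK seq_compactE by metis
  have lim_near: "(\<lambda>k. (f (u k) - u k) \<bullet> b i) \<longlonglongrightarrow> (f x - x) \<bullet> b i"
    if uK: "\<And>k. u k \<in> K" and u: "\<And>k. dist (u k) (z (r k)) \<le> real n * (2 * R) * inverse (Suc (r k))" for u i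
  proof -
    have "(\<lambda>k. real n * (2 * R) * inverse (Suc k)) \<longlonglongrightarrow> real n * (2 * R) * 0"
      by (intro tendsto_intros LIMSEQ_inverse_real_of_nat)
    from LIMSEQ_subseq_LIMSEQ[OF this r]
    have h: "(\<lambda>k. real n * (2 * R) * inverse (Suc (r k))) \<longlonglongrightarrow> 0" by (simp add: o_def)
    have "(\<lambda>k. dist (u k) (z (r k))) \<longlonglongrightarrow> 0"
      by (rule tendsto_sandwich[OF _ _ tendsto_const h]) (intro always_eventually allI zero_le_dist u)+
    moreover have "(\<lambda>k. dist (z (r k)) x) \<longlonglongrightarrow> 0" using tendsto_dist_iff[THEN iffD1, OF lim] by (simp add: o_def)
    ultimately have s: "(\<lambda>k. dist (u k) (z (r k)) + dist (z (r k)) x) \<longlonglongrightarrow> 0"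
      using tendsto_add by fastforce
    have "(\<lambda>k. dist (u k) x) \<longlonglongrightarrow> 0"
      by (rule tendsto_sandwich[OF _ _ tendsto_const s]) (intro always_eventually allI dist_triangle zero_le_dist)+
    then have ux: "u \<longlonglongrightarrow> x" using tendsto_dist_iff by blast
    then have "(\<lambda>k. f (u k)) \<longlonglongrightarrow> f x"
      using cont x uK unfolding continuous_on_sequentially by (auto simp: o_def)
    then show ?thesis using ux by (intro tendsto_intros)
  qed
  have "f x \<bullet> b i = x \<bullet> b i" if i: "i < n" for i
  proof -
    have "\<exists>u. \<forall>k. u k \<in> K \<and> dist (u k) (z (r k)) \<le> real n * (2 * R) * inverse (Suc (r k)) \<and>
        (f (u k) - u k) \<bullet> b i \<ge> 0"
      by (rule choice) (use z[OF i] in blast)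
    then obtain u where u: "\<And>k. u k \<in> K"
        "\<And>k. dist (u k) (z (r k)) \<le> real n * (2 * R) * inverse (Suc (r k))"
        "\<And>k. (f (u k) - u k) \<bullet> b i \<ge> 0"
      by blast
    have "\<exists>w. \<forall>k. w k \<in> K \<and> dist (w k) (z (r k)) \<le> real n * (2 * R) * inverse (Suc (r k)) \<and>
        (f (w k) - w k) \<bullet> b i \<le> 0"
      by (rule choice) (use z[OF i] in blast)
    then obtain w where w: "\<And>k. w k \<in> K"
        "\<And>k. dist (w k) (z (r k)) \<le> real n * (2 * R) * inverse (Suc (r k))"
        "\<And>k. (f (w k) - w k) \<bullet> b i \<le> 0"
      by blast
    have "0 \<le> (f x - x) \<bullet> b i" by (rule LIMSEQ_le_const[OF lim_near[OF u(1,2)]]) (use u(3) in blast)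
    moreover have "(f x - x) \<bullet> b i \<le> 0" by (rule LIMSEQ_le_const2[OF lim_near[OF w(1,2)]]) (use w(3) in blast)
    ultimately show ?thesis by (simp add: inner_diff_left)
  qed
  then have eq: "?P (\<lambda>i. f x \<bullet> b i) = ?P (\<lambda>i. x \<bullet> b i)" by simp
  have expand: "?P (\<lambda>i. y \<bullet> b i) = y" if y: "y \<in> K" for y
  proof -
    obtain t where t: "y = ?P t" using y unfolding K_def by blast
    show ?thesis unfolding t by (rule sum.cong) (simp_all add: coord)
  qed
  have "f x = x" using eq unfolding expand[OF x] expand[OF maps[OF x]] .
  then show ?thesis using that x by blast
qed

lemma orthonormal_sequence_span:
  fixes B :: "'a::real_inner set"
  assumes "finite B"
  obtains n and b :: "nat \<Rightarrow> 'a" where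
    "\<And>i j. i < n \<Longrightarrow> j < n \<Longrightarrow> b i \<bullet> b j = (if i = j then 1 else 0)"
    "span (b ` {..<n}) = span B"
proof -
  obtain C where C: "finite C" "span C = span B" "pairwise orthogonal C"
    using basis_orthogonal[OF assms] by blast
  define D where "D = C - {0}"
  have D: "finite D" "span D = span B" using C by (auto simp: D_def)
  obtain h where h: "bij_betw h {..<card D} D"
    using ex_bij_betw_nat_finite[OF D(1)] by (auto simp: lessThan_atLeast0)
  have hD: "h i \<in> D" if "i < card D" for i using h that by (auto simp: bij_betw_def)
  show ?thesis
  proof (rule that[of "card D" "\<lambda>i. sgn (h i)"])
    fix i j assume i: "i < card D" and j: "j < card D"
    show "sgn (h i) \<bullet> sgn (h j) = (if i = j then 1 else 0)"
    proof (cases "i = j")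
      case True
      then show ?thesis using hD[OF i] by (simp add: D_def dot_square_norm norm_sgn)
    next
      case False
      then have "h i \<noteq> h j" using h i j by (auto simp: bij_betw_def inj_on_def)
      then have "h i \<bullet> h j = 0"
        using C(3) hD[OF i] hD[OF j] by (auto simp: pairwise_def D_def orthogonal_def)
      then show ?thesis using False by (simp add: sgn_div_norm)
    qed
  next
    have hb: "h ` {..<card D} = D" using h by (simp add: bij_betw_def)
    have "(\<lambda>i. sgn (h i)) ` {..<card D} = sgn ` D" using image_image[of sgn h "{..<card D}"] hb by simp
    moreover have "span (sgn ` D) = span D"
      unfolding span_eq
    proof (intro conjI)
      show "sgn ` D \<subseteq> span D" by (auto simp: sgn_div_norm intro: span_mul span_base)
      have "v \<in> span (sgn ` D)" if "v \<in> D" for v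
      proof -
        have "v = norm v *\<^sub>R sgn v" by (cases "v = 0") (simp_all add: sgn_div_norm)
        then show ?thesis using span_mul[OF span_base, of "sgn v" "sgn ` D" "norm v"] that by auto
      qed
      then show "D \<subseteq> span (sgn ` D)" by blast
    qed
    ultimately show "span ((\<lambda>i. sgn (h i)) ` {..<card D}) = span B" using D(2) by simp
  qed
qed

lemma orthonormal_expansion:
  fixes b :: "nat \<Rightarrow> 'a::real_inner"
  assumes b: "\<And>i j. i < n \<Longrightarrow> j < n \<Longrightarrow> b i \<bullet> b j = (if i = j then 1 else 0)"
    and z: "z \<in> span (b ` {..<n})"
  shows "z = (\<Sum>i<n. (z \<bullet> b i) *\<^sub>R b i)"
  using z
proof (induction rule: span_induct)
  case base
  show ?case unfolding subspace_def
    by (auto simp: inner_add_left scaleR_add_left sum.distrib)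
       (metis (no_types, lifting) scaleR_scaleR scaleR_sum_right sum.cong)
next
  case (step x)
  then obtain j where j: "j < n" "x = b j" by auto
  have "(\<Sum>i<n. (b j \<bullet> b i) *\<^sub>R b i) = (\<Sum>i<n. if i = j then b j else 0)"
    using j by (intro sum.cong) (auto simp: b)
  also have "\<dots> = b j" using j(1) by simp
  finally show ?case using j(2) by simp
qed

lemma compact_cball_span:
  fixes c :: "'a::real_inner"
  assumes "finite B"
  shows "compact (cball c R \<inter> {x. x - c \<in> span B})"
proof -
  obtain n and b :: "nat \<Rightarrow> 'a" where b: "\<And>i j. i < n \<Longrightarrow> j < n \<Longrightarrow> b i \<bullet> b j = (if i = j then 1 else 0)"
    and span: "span (b ` {..<n}) = span B" using orthonormal_sequence_span[OF assms] by blast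
  let ?P = "\<lambda>t. \<Sum>i<n. t i *\<^sub>R b i"
  let ?K = "?P ` {t. \<forall>i<n. \<bar>t i\<bar> \<le> R}"
  have bs: "b i \<in> span B" if "i < n" for i using that span by (metis imageI lessThan_iff span_base)
  have "cball c R \<inter> {x. x - c \<in> span B} = cball c R \<inter> ((+) c ` ?K)"
  proof (intro equalityI subsetI)
    fix x assume x: "x \<in> cball c R \<inter> {x. x - c \<in> span B}"
    then have eq: "x - c = ?P (\<lambda>i. (x - c) \<bullet> b i)" using orthonormal_expansion[OF b] span by simp
    have "\<bar>(x - c) \<bullet> b i\<bar> \<le> R" if "i < n" for i
    proof -
      have "norm (b i) = 1" using b[OF that that] by (simp add: norm_eq_1)
      then show ?thesis using Cauchy_Schwarz_ineq2[of "x - c" "b i"] x by (simp add: dist_norm norm_minus_commute)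
    qed
    then have "x - c \<in> ?K" by (intro cube_sumI[OF eq])
    then have "c + (x - c) \<in> (+) c ` ?K" by blast
    then show "x \<in> cball c R \<inter> ((+) c ` ?K)" using x by simp
  next
    fix x assume "x \<in> cball c R \<inter> ((+) c ` ?K)"
    then show "x \<in> cball c R \<inter> {x. x - c \<in> span B}" using bs by (auto intro!: span_sum span_mul)
  qed
  moreover have "compact ((+) c ` ?K)" by (intro compact_translation compact_cube_sum)
  ultimately show ?thesis using closed_Int_compact by fastforce
qed

text \<open>
  The ball is a radial retract of the surrounding cube, so the fixed point of the retracted map on
  the cube lies in the ball.
\<close>

lemma brouwer_cball_span:
  fixes c :: "'a::real_inner" and B :: "'a set" and R :: real
  defines "S \<equiv> cball c R \<inter> {x. x - c \<in> span B}"
  assumes fin: "finite B" and R: "R > 0" and cont: "continuous_on S f"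
    and maps: "\<And>x. x \<in> S \<Longrightarrow> f x \<in> S"
  obtains x where "x \<in> S" "f x = x"
proof -
  obtain n and b :: "nat \<Rightarrow> 'a" where b: "\<And>i j. i < n \<Longrightarrow> j < n \<Longrightarrow> b i \<bullet> b j = (if i = j then 1 else 0)"
    and span: "span (b ` {..<n}) = span B" using orthonormal_sequence_span[OF fin] by blast
  let ?P = "\<lambda>t. \<Sum>i<n. t i *\<^sub>R b i"
  let ?K = "?P ` {t. \<forall>i<n. \<bar>t i\<bar> \<le> R}"
  have bs: "b i \<in> span B" if "i < n" for i using that span by (metis imageI lessThan_iff span_base)
  have Ks: "z \<in> span B" if "z \<in> ?K" for z using that bs by (auto intro!: span_sum span_mul)
  define \<pi> where "\<pi> z = c + (R / max R (norm z)) *\<^sub>R z" for z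
  have \<pi>S: "\<pi> z \<in> S" if "z \<in> span B" for z
  proof -
    have "R / max R (norm z) * norm z \<le> R" using R by (simp add: field_simps max_def)
    then show ?thesis using that R by (auto simp: S_def \<pi>_def dist_norm intro: span_mul)
  qed
  define g where "g z = f (\<pi> z) - c" for z
  have gS: "g z \<in> span B" "norm (g z) \<le> R" if "z \<in> span B" for z
    using maps[OF \<pi>S[OF that]] by (auto simp: g_def S_def dist_norm norm_minus_commute)
  have "continuous_on ?K (\<lambda>z. f (\<pi> z))"
  proof (rule continuous_on_compose2[OF cont])
    show "continuous_on ?K \<pi>" unfolding \<pi>_def using R by (intro continuous_intros) (auto simp: max_def)
  qed (use \<pi>S Ks in blast)
  then have "continuous_on ?K g" unfolding g_def by (intro continuous_intros)
  moreover have "g z \<in> ?K" if "z \<in> ?K" for z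
  proof -
    note gz = gS[OF Ks[OF that]]
    have "\<bar>g z \<bullet> b i\<bar> \<le> R" if "i < n" for i
    proof -
      have "norm (b i) = 1" using b[OF that that] by (simp add: norm_eq_1)
      then show ?thesis using Cauchy_Schwarz_ineq2[of "g z" "b i"] gz(2) by simp
    qed
    moreover have "g z = ?P (\<lambda>i. g z \<bullet> b i)" using gz(1) span by (intro orthonormal_expansion b) auto
    ultimately show ?thesis by (intro cube_sumI)
  qed
  ultimately obtain z where z: "z \<in> ?K" "g z = z"
    using brouwer_orthonormal_cube[OF b R, of n] by blast
  have "norm z \<le> R" using gS(2)[OF Ks[OF z(1)]] z(2) by simp
  then have "\<pi> z = c + z" using R by (simp add: \<pi>_def max_def)
  then have "f (c + z) = c + z" using z(2) by (simp add: g_def algebra_simps)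
  moreover have "c + z \<in> S" using \<pi>S[OF Ks[OF z(1)]] \<open>\<pi> z = c + z\<close> by simp
  ultimately show ?thesis using that by blast
qed

text \<open>
  A continuous vector field on a finite-dimensional ball vanishes somewhere, or points straight to
  the centre at some boundary point: consider a fixed point of \<open>x \<mapsto> x - v x\<close>
  followed by the radial retraction onto the ball.
\<close>

lemma field_zero_or_inward:
  fixes c :: "'a::real_inner" and B :: "'a set" and R :: real
  defines "S \<equiv> cball c R \<inter> {x. x - c \<in> span B}"
  assumes fin: "finite B" and R: "R > 0" and cont: "continuous_on S v"
    and v: "\<And>x. x \<in> S \<Longrightarrow> v x \<in> span B"
  obtains x where "x \<in> S" "v x = 0"
  | x t where "x \<in> S" "norm (x - c) = R" "t > 0" "v x = - t *\<^sub>R (x - c)"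
proof -
  define z where "z x = x - c - v x" for x
  define f where "f x = c + (R / max R (norm (z x))) *\<^sub>R z x" for x
  have "f x \<in> S" if "x \<in> S" for x
  proof -
    have "z x \<in> span B" using that v[OF that] by (auto simp: z_def S_def intro: span_diff)
    moreover have "R / max R (norm (z x)) * norm (z x) \<le> R" using R by (simp add: field_simps max_def)
    ultimately show ?thesis using R by (auto simp: S_def f_def dist_norm intro: span_mul)
  qed
  moreover have "continuous_on S f"
    unfolding f_def z_def using R by (intro continuous_intros cont) (auto simp: max_def)
  ultimately obtain x where x: "x \<in> S" "f x = x"
    using brouwer_cball_span[OF fin R, of c f] unfolding S_def by blast
  have eq: "x - c = (R / max R (norm (z x))) *\<^sub>R z x" using x(2) by (simp add: f_def algebra_simps)
  show ?thesis
  proof (cases "norm (z x) \<le> R")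
    case True
    then have "x - c = z x" using eq R by (simp add: max_def)
    then have "v x = 0" by (simp add: z_def)
    then show ?thesis using that x by blast
  next
    case False
    then have eq': "x - c = (R / norm (z x)) *\<^sub>R z x" using eq by (simp add: max_def)
    have nz: "norm (z x) > 0" using False R by linarith
    have "norm (x - c) = R" unfolding eq' using R nz by simp
    moreover have "z x = (norm (z x) / R) *\<^sub>R (x - c)" unfolding eq' using R nz by simp
    then have "v x = - (norm (z x) / R - 1) *\<^sub>R (x - c)" by (simp add: z_def algebra_simps)
    moreover have "norm (z x) / R - 1 > 0" using False R by simp
    ultimately show ?thesis using that x by blast
  qed
qed

section \<open>Support functions and upper hemicontinuity\<close>

text \<open>
  The empty set is covered as well; the distance to it is \<open>0\<close> by convention and would not do.
\<close>

lemma continuous_zero_set: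
  fixes C :: "'a::metric_space set"
  assumes "closed C"
  obtains w :: "'a \<Rightarrow> real" where "continuous_on UNIV w" "\<And>x. 0 \<le> w x" "\<And>x. w x = 0 \<longleftrightarrow> x \<in> C"
proof (cases "C = {}")
  case True
  then show ?thesis using that[of "\<lambda>_. 1"] by simp
next
  case False
  show ?thesis
  proof (rule that[of "\<lambda>x. infdist x C"])
    show "continuous_on UNIV (\<lambda>x. infdist x C)" by (intro continuous_intros)
  qed (use False assms infdist_nonneg in_closed_iff_infdist_zero in auto)
qed

lemma inner_le_support_fun:
  assumes "bounded A" "y \<in> A"
  shows "y \<bullet> v \<le> support_fun v A"
  unfolding support_fun_def
proof (rule cSUP_upper[OF assms(2)])
  obtain M where "\<And>y. y \<in> A \<Longrightarrow> norm y \<le> M" using assms(1) by (auto simp: bounded_iff)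
  then have "y \<bullet> v \<le> M * norm v" if "y \<in> A" for y
    using that norm_cauchy_schwarz[of y v] by (meson mult_right_mono norm_ge_zero order_trans)
  then show "bdd_above ((\<lambda>y. y \<bullet> v) ` A)" by (rule bdd_aboveI2)
qed

lemma c_uhc_on_support_fun_ge:
  assumes "c_uhc_on M F" "\<And>k. X k \<in> M" "x \<in> M" "weakly_converges X x"
    and "\<forall>\<^sub>F k in sequentially. c \<le> support_fun v (F (X k))"
  shows "c \<le> support_fun v (F x)"
proof -
  have "ereal c \<le> limsup (\<lambda>k. ereal (support_fun v (F (X k))))"
    using assms(5) by (intro le_Limsup) auto
  also have "\<dots> \<le> ereal (support_fun v (F x))"
    using assms(1-4) unfolding c_uhc_on_def by blast
  finally show ?thesis by simp
qed

lemma closed_support_fun_ge: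
  assumes "c_uhc_on M F" "closed M"
  shows "closed {x \<in> M. c \<le> support_fun v (F x)}"
  unfolding closed_sequential_limits
proof (intro allI impI)
  fix X x assume X: "(\<forall>k. X k \<in> {x \<in> M. c \<le> support_fun v (F x)}) \<and> X \<longlonglongrightarrow> x"
  then have "x \<in> M" using assms(2) closed_sequentially by blast
  moreover have "c \<le> support_fun v (F x)"
    using X \<open>x \<in> M\<close>
    by (intro c_uhc_on_support_fun_ge[OF assms(1), of X]) (auto intro: weakly_converges_of_convergent)
  ultimately show "x \<in> {x \<in> M. c \<le> support_fun v (F x)}" by simp
qed

text \<open>
  Separation from a closed convex set. By boundedness of \<open>A\<close> the strictly separating direction
  may be moved slightly, into a dense set of directions.
\<close>

lemma mem_cbc_of_support_fun_dense:
  fixes A :: "'a::{real_inner, banach} set"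
  assumes A: "A \<in> cbc" and T: "closure T = UNIV"
    and le: "\<And>v. v \<in> T \<Longrightarrow> y \<bullet> v \<le> support_fun v A"
  shows "y \<in> A"
proof (rule ccontr)
  assume "y \<notin> A"
  have ne: "A \<noteq> {}" using A by (simp add: cbc_def)
  obtain p where p: "p \<in> A" "\<And>z. z \<in> A \<Longrightarrow> (y - p) \<bullet> (z - p) \<le> 0"
    using projection_hilbert[of A y] A by (auto simp: cbc_def)
  define a where "a = y - p"
  have "a \<noteq> 0" using p(1) \<open>y \<notin> A\<close> by (auto simp: a_def)
  obtain M0 where M0: "\<And>z. z \<in> A \<Longrightarrow> norm z \<le> M0"
    using A by (auto simp: cbc_def bounded_iff)
  define M where "M = M0 + norm y + 1"
  have M: "norm (z - y) \<le> M" if "z \<in> A" for z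
    using M0[OF that] norm_triangle_ineq4[of z y] by (simp add: M_def)
  have M_pos: "0 < M" unfolding M_def using M0[OF p(1)] norm_ge_zero[of p] norm_ge_zero[of y] by linarith
  define e where "e = a \<bullet> a / (2 * M)"
  have "e > 0" using \<open>a \<noteq> 0\<close> M_pos by (simp add: e_def)
  then obtain v where v: "v \<in> T" "dist v a < e"
    using T closure_approachable[of a T] by auto
  have "z \<bullet> v \<le> y \<bullet> v - a \<bullet> a / 2" if z: "z \<in> A" for z
  proof -
    have "(z - y) \<bullet> a \<le> - (a \<bullet> a)"
      using p(2)[OF z] by (simp add: a_def algebra_simps inner_commute)
    moreover have "(z - y) \<bullet> (v - a) \<le> a \<bullet> a / 2"
    proof -
      have "(z - y) \<bullet> (v - a) \<le> norm (z - y) * norm (v - a)" by (rule norm_cauchy_schwarz)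
      also have "\<dots> \<le> M * e"
        using M[OF z] M_pos v(2) by (intro mult_mono) (auto simp: dist_norm)
      also have "\<dots> = a \<bullet> a / 2" using M_pos by (simp add: e_def)
      finally show ?thesis .
    qed
    ultimately show ?thesis by (simp add: inner_diff_left inner_diff_right)
  qed
  then have "support_fun v A \<le> y \<bullet> v - a \<bullet> a / 2"
    unfolding support_fun_def by (intro cSUP_least ne)
  then show False using le[OF v(1)] \<open>a \<noteq> 0\<close> inner_gt_zero_iff[of a] by linarith
qed

section \<open>Solvability of the inclusion\<close>

text \<open>
  The inclusion tested against a finite-dimensional space \<open>span B\<close>. Let \<open>S\<close> be the section
  of the ball \<open>cball xt R\<close> by \<open>xt + span B\<close>. If the tested inclusion fails at every point of
  the compact set \<open>S \<inter> D\<close>, finitely many directions \<open>u\<close> suffice to separate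
  \<open>ybar\<close> strictly from \<open>F x\<close> at all points \<open>x\<close> of that set. Weighting them
  continuously, and adding the radial field \<open>x - xt\<close> with a weight that vanishes exactly on
  \<open>D\<close>, gives a field \<open>v\<close> on \<open>S\<close> such that
  \<open>(y - ybar) \<bullet> v x < 0\<close> for the points \<open>y \<in> F x\<close> supplied by \<open>sel\<close>. Such a
  field has no zero, and by the second part of \<open>sel\<close> it nowhere points to the centre from the
  boundary, which is impossible. The set \<open>D\<close> serves to localise the solution.
\<close>

lemma galerkin_solution:
  fixes xt ybar :: "'a::real_inner" and F :: "'a \<Rightarrow> 'a set"
  assumes B: "finite B" and R: "R > 0" and D: "closed D"
    and bdd: "\<And>x. x \<in> cball xt R \<Longrightarrow> bounded (F x)"
    and closed: "\<And>u. closed {x \<in> cball xt R. ybar \<bullet> u \<le> support_fun u (F x)}"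
    and sel: "\<And>x. x \<in> cball xt R \<Longrightarrow> \<exists>y\<in>F x. (x \<notin> D \<longrightarrow> (y - ybar) \<bullet> (x - xt) < 0) \<and>
                (norm (x - xt) = R \<longrightarrow> (y - ybar) \<bullet> (x - xt) \<le> 0)"
  obtains x where "x \<in> D" "x \<in> cball xt R" "\<And>u. u \<in> span B \<Longrightarrow> ybar \<bullet> u \<le> support_fun u (F x)"
proof -
  define S where "S = cball xt R \<inter> {x. x - xt \<in> span B}"
  define C where "C u = {x \<in> cball xt R. ybar \<bullet> u \<le> support_fun u (F x)}" for u
  have "\<exists>x\<in>S \<inter> D. \<forall>u\<in>span B. x \<in> C u"
  proof (rule ccontr)
    assume none: "\<not> ?thesis"
    have "compact (S \<inter> D)"
      unfolding S_def by (intro compact_Int_closed compact_cball_span B D)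
    moreover have "open (- C u)" for u using closed unfolding C_def by blast
    moreover have "S \<inter> D \<subseteq> (\<Union>u\<in>span B. - C u)" using none by blast
    ultimately obtain T where T: "T \<subseteq> span B" "finite T" "S \<inter> D \<subseteq> (\<Union>u\<in>T. - C u)"
      by (rule compactE_image)
    have "\<exists>w. continuous_on UNIV w \<and> (\<forall>x. 0 \<le> w x) \<and> (\<forall>x. w x = (0::real) \<longleftrightarrow> x \<in> C u)" for u
    proof (rule continuous_zero_set[of "C u"])
      show "closed (C u)" using closed by (simp add: C_def)
    qed blast
    then obtain w where w: "\<And>u. continuous_on UNIV (w u)" "\<And>u x. 0 \<le> w u x"
        "\<And>u x. w u x = (0::real) \<longleftrightarrow> x \<in> C u"
      by metis
    obtain w0 :: "'a \<Rightarrow> real" where w0: "continuous_on UNIV w0" "\<And>x. 0 \<le> w0 x" "\<And>x. w0 x = 0 \<longleftrightarrow> x \<in> D"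
      using continuous_zero_set[OF D] by blast
    \<comment> \<open>The weight \<open>w u\<close> vanishes exactly where the direction \<open>u\<close> does not separate.\<close>
    define v where "v x = (\<Sum>u\<in>T. w u x *\<^sub>R u) + w0 x *\<^sub>R (x - xt)" for x
    have neg: "(y - ybar) \<bullet> v x < 0"
      if x: "x \<in> S" and y: "y \<in> F x" "x \<notin> D \<longrightarrow> (y - ybar) \<bullet> (x - xt) < 0" for x y
    proof -
      have xR: "x \<in> cball xt R" using x by (simp add: S_def)
      have pos: "(y - ybar) \<bullet> u < 0" if "x \<notin> C u" for u
        using inner_le_support_fun[OF bdd[OF xR] y(1), of u] that xR by (simp add: C_def inner_diff_left)
      have nonpos: "w u x * ((y - ybar) \<bullet> u) \<le> 0" for u
        using pos[of u] w(2)[of u x] w(3)[of u x] by (cases "x \<in> C u") (auto simp: mult_nonneg_nonpos)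
      have eq: "(y - ybar) \<bullet> v x = (\<Sum>u\<in>T. w u x * ((y - ybar) \<bullet> u)) + w0 x * ((y - ybar) \<bullet> (x - xt))"
        by (simp add: v_def inner_add_right inner_sum_right)
      show ?thesis
      proof (cases "x \<in> D")
        case True
        then obtain u where u: "u \<in> T" "x \<notin> C u" using T(3) x by blast
        then have "w u x > 0" using w(2)[of u x] w(3)[of u x] by linarith
        then have "w u x * ((y - ybar) \<bullet> u) < 0" using pos[OF u(2)] by (rule mult_pos_neg)
        moreover have "(\<Sum>u\<in>T. w u x * ((y - ybar) \<bullet> u)) \<le> w u x * ((y - ybar) \<bullet> u)"
          using sum_nonpos[of "T - {u}" "\<lambda>u. w u x * ((y - ybar) \<bullet> u)"] nonpos
            sum.remove[OF T(2) u(1), of "\<lambda>u. w u x * ((y - ybar) \<bullet> u)"] by simp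
        moreover have "w0 x = 0" using True w0(3) by blast
        ultimately show ?thesis unfolding eq by simp
      next
        case False
        then have "w0 x > 0" using w0(2)[of x] w0(3)[of x] by linarith
        then have "w0 x * ((y - ybar) \<bullet> (x - xt)) < 0" using False y(2) by (simp add: mult_pos_neg)
        moreover have "(\<Sum>u\<in>T. w u x * ((y - ybar) \<bullet> u)) \<le> 0" by (intro sum_nonpos nonpos)
        ultimately show ?thesis unfolding eq by linarith
      qed
    qed
    have "continuous_on S v"
      unfolding v_def
      by (intro continuous_intros continuous_on_subset[OF w(1)] continuous_on_subset[OF w0(1)]) auto
    moreover have "v x \<in> span B" if "x \<in> S" for x
      unfolding v_def using that T(1) by (intro span_add span_sum span_mul) (auto simp: S_def)
    ultimately show False
      unfolding S_def
    proof (rule field_zero_or_inward[OF B R])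
      fix x assume "x \<in> cball xt R \<inter> {x. x - xt \<in> span B}" and v0: "v x = 0"
      then have x: "x \<in> S" by (simp add: S_def)
      then obtain y where "y \<in> F x" "x \<notin> D \<longrightarrow> (y - ybar) \<bullet> (x - xt) < 0"
        using sel[of x] by (auto simp: S_def)
      from neg[OF x this] v0 show False by simp
    next
      fix x t assume "x \<in> cball xt R \<inter> {x. x - xt \<in> span B}" and nR: "norm (x - xt) = R"
        and t: "t > 0" "v x = - t *\<^sub>R (x - xt)"
      then have x: "x \<in> S" by (simp add: S_def)
      then obtain y where y: "y \<in> F x" "x \<notin> D \<longrightarrow> (y - ybar) \<bullet> (x - xt) < 0"
        and yR: "(y - ybar) \<bullet> (x - xt) \<le> 0"
        using sel[of x] nR by (auto simp: S_def)
      have "(y - ybar) \<bullet> v x = - (t * ((y - ybar) \<bullet> (x - xt)))" unfolding t(2) by simp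
      moreover have "t * ((y - ybar) \<bullet> (x - xt)) \<le> 0" using t(1) yR by (simp add: mult_nonneg_nonpos)
      ultimately show False using neg[OF x y] by linarith
    qed
  qed
  then show ?thesis using that by (auto simp: C_def S_def)
qed

text \<open>
  Passage to the limit in the finite-dimensional problems along the spans of a dense sequence. The
  finite-dimensional solutions have a weak cluster point in \<open>D\<close>, and compact upper
  hemicontinuity preserves each of the inequalities \<open>ybar \<bullet> v \<le> support_fun v (F x)\<close>.
\<close>

lemma c_uhc_solution:
  fixes xt ybar :: "'a::{real_inner, banach}" and F :: "'a \<Rightarrow> 'a set"
  assumes sep: "separable_space (euclidean :: 'a topology)"
    and R: "R > 0" and cbc: "\<And>x. x \<in> cball xt R \<Longrightarrow> F x \<in> cbc"
    and uhc: "c_uhc_on (cball xt R) F"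
    and D: "closed D" "weakly_seq_closed D"
    and sel: "\<And>x. x \<in> cball xt R \<Longrightarrow> \<exists>y\<in>F x. (x \<notin> D \<longrightarrow> (y - ybar) \<bullet> (x - xt) < 0) \<and>
                (norm (x - xt) = R \<longrightarrow> (y - ybar) \<bullet> (x - xt) \<le> 0)"
  obtains x where "x \<in> D" "x \<in> cball xt R" "ybar \<in> F x"
proof -
  obtain d :: "nat \<Rightarrow> 'a" where d: "closure (range d) = UNIV"
    using separable_space_dense_sequence[OF sep] .
  have "\<exists>x. x \<in> D \<and> x \<in> cball xt R \<and> (\<forall>u\<in>span (d ` {..n}). ybar \<bullet> u \<le> support_fun u (F x))" for n
  proof (rule galerkin_solution[of "d ` {..n}" R D xt F ybar])
    show "bounded (F x)" if "x \<in> cball xt R" for x using cbc[OF that] by (simp add: cbc_def)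
    show "closed {x \<in> cball xt R. ybar \<bullet> u \<le> support_fun u (F x)}" for u
      using uhc by (rule closed_support_fun_ge) simp
  qed (use R D sel in auto)
  then obtain X where XD: "\<And>n. X n \<in> D" and XR: "\<And>n. X n \<in> cball xt R"
    and X: "\<And>n u. u \<in> span (d ` {..n}) \<Longrightarrow> ybar \<bullet> u \<le> support_fun u (F (X n))"
    by metis
  have "norm (X n) \<le> norm xt + R" for n
    using XR[of n] norm_triangle_ineq[of xt "X n - xt"] by (simp add: dist_norm norm_minus_commute)
  then obtain r x where r: "strict_mono r" and lim: "weakly_converges (X \<circ> r) x"
    by (rule bounded_weakly_convergent_subsequence[OF sep])
  have xD: "x \<in> D" using D(2) XD lim unfolding weakly_seq_closed_def by (metis comp_apply)
  have xR: "x \<in> cball xt R"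
    using weakly_seq_closed_cball[of xt R] XR lim unfolding weakly_seq_closed_def by (metis comp_apply)
  have "ybar \<bullet> v \<le> support_fun v (F x)" if v: "v \<in> range d" for v
  proof -
    obtain m where m: "v = d m" using v by blast
    show ?thesis
    proof (rule c_uhc_on_support_fun_ge[OF uhc _ xR lim])
      show "\<forall>\<^sub>F k in sequentially. ybar \<bullet> v \<le> support_fun v (F ((X \<circ> r) k))"
      proof (rule eventually_sequentiallyI[of m])
        fix k assume "m \<le> k"
        then have "m \<le> r k" using seq_suble[OF r, of k] by linarith
        then show "ybar \<bullet> v \<le> support_fun v (F ((X \<circ> r) k))"
          unfolding m comp_apply by (intro X span_base) auto
      qed
    qed (use XR in auto)
  qed
  then have "ybar \<in> F x" by (rule mem_cbc_of_support_fun_dense[OF cbc[OF xR] d])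
  then show ?thesis using that xD xR by blast
qed

text \<open>
  The asserted ball is the set \<open>D\<close> of all \<open>x\<close> with
  \<open>(ybar - yt) \<bullet> (x - xt) \<le> l * (norm (x - xt))\<^sup>2\<close>. Outside \<open>D\<close> the dissipativity
  hypothesis therefore provides some \<open>y \<in> F x\<close> with \<open>(y - ybar) \<bullet> (x - xt) < 0\<close>, and
  on the sphere of radius \<open>R\<close> the bound on \<open>norm (ybar - yt)\<close> gives the weak inequality.
\<close>

lemma dissipative_inclusion_solvable:
  fixes xt ybar yt :: "'a::{real_inner, banach}" and F :: "'a \<Rightarrow> 'a set" and R l :: real
  defines "xc \<equiv> xt + (1 / (2 * l)) *\<^sub>R (ybar - yt)"
  assumes sep: "separable_space (euclidean :: 'a topology)"
    and R: "R > 0" and l: "l < 0" and cbc: "\<And>x. x \<in> cball xt R \<Longrightarrow> F x \<in> cbc"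
    and uhc: "c_uhc_on (cball xt R) F"
    and yt: "norm (ybar - yt) \<le> - l * R"
    and diss: "\<And>x. x \<in> cball xt R \<Longrightarrow> \<exists>y\<in>F x. (y - yt) \<bullet> (x - xt) \<le> l * (norm (x - xt))\<^sup>2"
  obtains x where "x \<in> cball xc (- (1 / (2 * l)) * norm (yt - ybar))" "ybar \<in> F x"
proof -
  define w where "w = ybar - yt"
  define \<rho> where "\<rho> = - (1 / (2 * l)) * norm (yt - ybar)"
  have \<rho>0: "\<rho> \<ge> 0" using l by (simp add: \<rho>_def divide_nonneg_neg)
  have mem_D: "x \<in> cball xc \<rho> \<longleftrightarrow> w \<bullet> (x - xt) \<le> l * (norm (x - xt))\<^sup>2" for x
  proof -
    have \<rho>2: "\<rho>\<^sup>2 = (1 / (2 * l))\<^sup>2 * (w \<bullet> w)"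
      by (simp add: \<rho>_def w_def power_divide norm_minus_commute[of yt] power2_norm_eq_inner)
    have "(norm (x - xc))\<^sup>2 = (norm (x - xt - (1 / (2 * l)) *\<^sub>R w))\<^sup>2"
      by (simp add: xc_def w_def diff_diff_eq)
    also have "\<dots> = (norm (x - xt))\<^sup>2 - (1 / l) * (w \<bullet> (x - xt)) + \<rho>\<^sup>2"
      unfolding \<rho>2 power2_norm_eq_inner inner_diff_left[of "x - xt"] inner_diff_right[of _ "x - xt"]
      by (simp add: inner_commute power2_eq_square)
    finally have eq: "(norm (x - xc))\<^sup>2 - \<rho>\<^sup>2 = (norm (x - xt))\<^sup>2 - (1 / l) * (w \<bullet> (x - xt))" by simp
    have "x \<in> cball xc \<rho> \<longleftrightarrow> (norm (x - xc))\<^sup>2 \<le> \<rho>\<^sup>2"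
      using \<rho>0 by (simp add: dist_norm norm_minus_commute)
    also have "\<dots> \<longleftrightarrow> (norm (x - xt))\<^sup>2 \<le> (1 / l) * (w \<bullet> (x - xt))" using eq by linarith
    also have "\<dots> \<longleftrightarrow> w \<bullet> (x - xt) \<le> l * (norm (x - xt))\<^sup>2" using l by (simp add: field_simps)
    finally show ?thesis .
  qed
  obtain x where "x \<in> cball xc \<rho>" "x \<in> cball xt R" "ybar \<in> F x"
  proof (rule c_uhc_solution[OF sep R cbc uhc, of "cball xc \<rho>" ybar])
    show "weakly_seq_closed (cball xc \<rho>)" by (rule weakly_seq_closed_cball)
  next
    fix x assume "x \<in> cball xt R"
    then obtain y where y: "y \<in> F x" "(y - yt) \<bullet> (x - xt) \<le> l * (norm (x - xt))\<^sup>2" using diss by blast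
    have split: "(y - yt) \<bullet> (x - xt) = (y - ybar) \<bullet> (x - xt) + w \<bullet> (x - xt)"
      by (simp add: w_def inner_diff_left)
    have "(y - ybar) \<bullet> (x - xt) \<le> 0" if nR: "norm (x - xt) = R"
    proof -
      have "- (w \<bullet> (x - xt)) \<le> norm w * norm (x - xt)"
        using Cauchy_Schwarz_ineq2[of w "x - xt"] by linarith
      also have "\<dots> \<le> (- l * R) * R" using yt R unfolding nR w_def by (rule mult_right_mono[OF _ less_imp_le])
      finally have "l * (norm (x - xt))\<^sup>2 \<le> w \<bullet> (x - xt)" by (simp add: nR power2_eq_square)
      then show ?thesis using y(2) split by linarith
    qed
    moreover have "(y - ybar) \<bullet> (x - xt) < 0" if "x \<notin> cball xc \<rho>"
      using that y(2) split unfolding mem_D by linarith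
    ultimately show "\<exists>y\<in>F x. (x \<notin> cball xc \<rho> \<longrightarrow> (y - ybar) \<bullet> (x - xt) < 0) \<and>
        (norm (x - xt) = R \<longrightarrow> (y - ybar) \<bullet> (x - xt) \<le> 0)"
      using y(1) by blast
  qed auto
  then show ?thesis using that unfolding \<rho>_def by blast
qed

section \<open>Lower bound on the distance of solutions\<close>

lemma infdist_le_excess:
  assumes "bounded M" "M' \<noteq> {}" "y \<in> M"
  shows "infdist y M' \<le> excess M M'"
  unfolding excess_def
proof (rule cSUP_upper[OF assms(3)])
  obtain a where a: "a \<in> M'" using assms(2) by blast
  obtain K where "\<And>z. z \<in> M \<Longrightarrow> dist a z \<le> K" using assms(1) bounded_any_center[of M a] by blast
  then have "infdist z M' \<le> K" if "z \<in> M" for z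
    using infdist_le[OF a, of z] that by (metis dist_commute order_trans)
  then show "bdd_above ((\<lambda>x. infdist x M') ` M)" by (rule bdd_aboveI2)
qed

text \<open>
  If \<open>x\<close> were closer to \<open>xt\<close> than \<open>r\<close>, then monotonicity and the bound on the excess would force
  the value of \<open>\<omega>\<close> at \<open>norm (x - xt)\<close> to be \<open>infdist ybar (F xt)\<close>, against minimality.
\<close>

lemma preimage_outside_modulus_ball:
  fixes xt ybar :: "'a::real_normed_vector"
  assumes \<omega>: "modulus_of_continuity \<omega>"
    and ne: "modulus_preimage \<omega> (infdist ybar (F xt)) \<noteq> {}"
    and r: "r \<le> (LEAST t. t \<in> modulus_preimage \<omega> (infdist ybar (F xt)))"
    and ex: "x \<in> cball xt r \<Longrightarrow> excess (F x) (F xt) \<le> \<omega> (norm (x - xt))"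
    and F: "bounded (F x)" "F xt \<noteq> {}" "ybar \<in> F x"
  shows "r \<le> norm (x - xt)"
proof (rule ccontr)
  let ?d = "infdist ybar (F xt)" and ?s = "norm (x - xt)"
  define t0 where "t0 = (LEAST t. t \<in> modulus_preimage \<omega> ?d)"
  have t0: "t0 \<in> modulus_preimage \<omega> ?d" unfolding t0_def by (rule modulus_preimage_Least(1)[OF \<omega> ne])
  assume "\<not> r \<le> ?s"
  then have s: "?s < r" "?s < t0" using r by (auto simp: t0_def)
  have "?d \<le> excess (F x) (F xt)" by (rule infdist_le_excess[OF F])
  also have "\<dots> \<le> \<omega> ?s" using s(1) by (intro ex) (simp add: dist_norm norm_minus_commute)
  finally have "?d \<le> \<omega> ?s" .
  moreover have "mono_on {0..} \<omega>" using \<omega> by (simp add: modulus_of_continuity_def)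
  then have "\<omega> ?s \<le> \<omega> t0"
    by (rule mono_onD) (use s(2) t0 in \<open>auto simp: modulus_preimage_def\<close>)
  moreover have "\<omega> t0 = ?d" using t0 by (simp add: modulus_preimage_def)
  ultimately have "?s \<in> modulus_preimage \<omega> ?d" by (simp add: modulus_preimage_def)
  then have "t0 \<le> ?s" unfolding t0_def by (rule modulus_preimage_Least(2)[OF \<omega> ne])
  then show False using s(2) by simp
qed

section \<open>Existence and localisation of solutions\<close>

theorem theorem9:
  fixes xt ybar :: "'a::{real_inner, banach}"
    and R l :: real
    and F :: "'a \<Rightarrow> 'a set"
  assumes "separable_space (euclidean :: 'a topology)"
    and "R > 0" and "l < 0"
    and "\<forall>x\<in>cball xt R. F x \<in> cbc"
  shows
    "(bounded (\<Union>x\<in>cball xt R. F x) \<and> c_uhc_on (cball xt R) F \<longrightarrow>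
        (\<forall>yt\<in>F xt.
           norm (ybar - yt) \<le> - l * R \<and>
           (\<forall>x\<in>cball xt R. \<exists>y\<in>F x. (y - yt) \<bullet> (x - xt) \<le> l * (norm (x - xt))\<^sup>2) \<longrightarrow>
           (let xc = xt + (1 / (2 * l)) *\<^sub>R (ybar - yt) in
              \<exists>xbar\<in>cball xc (- (1 / (2 * l)) * norm (yt - ybar)). ybar \<in> F xbar)))
     \<and>
     (\<forall>\<omega> r. modulus_of_continuity \<omega> \<and> r \<le> R \<and>
        modulus_preimage \<omega> (infdist ybar (F xt)) \<noteq> {} \<and>
        r \<le> (LEAST t. t \<in> modulus_preimage \<omega> (infdist ybar (F xt))) \<and>
        (\<forall>x\<in>cball xt r. excess (F x) (F xt) \<le> \<omega> (norm (x - xt))) \<longrightarrow>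
        (\<forall>x\<in>set_valued_preimage F ybar \<inter> cball xt R. norm (x - xt) \<ge> r))"
proof (intro conjI allI impI ballI)
  fix yt
  assume F: "bounded (\<Union>x\<in>cball xt R. F x) \<and> c_uhc_on (cball xt R) F"
    and yt: "norm (ybar - yt) \<le> - l * R \<and>
      (\<forall>x\<in>cball xt R. \<exists>y\<in>F x. (y - yt) \<bullet> (x - xt) \<le> l * (norm (x - xt))\<^sup>2)"
  obtain x where "x \<in> cball (xt + (1 / (2 * l)) *\<^sub>R (ybar - yt)) (- (1 / (2 * l)) * norm (yt - ybar))"
      "ybar \<in> F x"
    by (rule dissipative_inclusion_solvable[OF assms(1-3), of xt F ybar yt]) (use assms(4) F yt in auto)
  then show "let xc = xt + (1 / (2 * l)) *\<^sub>R (ybar - yt) in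
      \<exists>xbar\<in>cball xc (- (1 / (2 * l)) * norm (yt - ybar)). ybar \<in> F xbar"
    unfolding Let_def by blast
next
  fix \<omega> r x
  assume h: "modulus_of_continuity \<omega> \<and> r \<le> R \<and>
        modulus_preimage \<omega> (infdist ybar (F xt)) \<noteq> {} \<and>
        r \<le> (LEAST t. t \<in> modulus_preimage \<omega> (infdist ybar (F xt))) \<and>
        (\<forall>x\<in>cball xt r. excess (F x) (F xt) \<le> \<omega> (norm (x - xt)))"
    and x: "x \<in> set_valued_preimage F ybar \<inter> cball xt R"
  have "xt \<in> cball xt R" using assms(2) by simp
  then have "bounded (F x)" "F xt \<noteq> {}" "ybar \<in> F x"
    using assms(4) x by (auto simp: cbc_def set_valued_preimage_def)
  then show "r \<le> norm (x - xt)"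
    using h by (intro preimage_outside_modulus_ball[of \<omega> ybar F xt r x]) auto
qed

end
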